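(* Let $(Y_t)_{t\ge0}$ be a (time homogeneous) continuous-time Markov chain on a finite state space $S$ with infinitesimal generator $G$, and let $f:S\to\mathbb{R}$ be an injective function. Let $(X_t)_{t\ge0}$ denote the path integral process of $f\circ Y$, $$X_t=\int_0^t f(Y_s)\,\mathrm{d}s .$$ Then for all $t\ge0$, all $u\in\mathbb{R}$ and all $y_0\in S$, the (conditional) characteristic function of $X_t$ is given by $$\mathbb{E}\left(e^{iuX_t}\,\middle|\,Y_0=y_0\right)=\left(e^{t(G+iuM_f)}\mathbf{1}\right)(y_0),$$ where $\mathbf{1}:S\to\{1\}$ is the constant function $1$ and $M_f$ is the operator of multiplication by $f$ on functions on $S$, i.e. $(M_f g)(y)=f(y)g(y)$.
   Context: A stochastic process $(Y_t)_{t\ge 0}$ on a countable state space $S$ is a time homogeneous continuous-time Markov chain if it is memoryless, i.e. $\mathbb{P}(Y_t=\beta\mid Y_{t_1}=\alpha_1,\dots,Y_{t_n}=\alpha_n)=\mathbb{P}(Y_t=\beta\mid Y_{t_1}=\alpha_1)$ for all times $t>t_1>t_2>\dots>t_n\ge 0$ and all states $\alpha_1,\dots,\alpha_n,\beta\in S$, and there are transition matrices $P(t)=(P(t)_{\alpha\beta})_{\alpha,\beta\in S}$, $t\ge0$, with $\mathbb{P}(Y_{s+t}=\beta\mid Y_s=\alpha)=P(t)_{\alpha\beta}$ for all $s,t\ge0$ and $\alpha,\beta\in S$, satisfying $P(0)=\mathrm{id}$, $\lim_{t\searrow0}P(t)=\mathrm{id}$ and $P(t+s)=P(t)P(s)$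 for all $s,t\ge0$. The infinitesimal generator is the unique matrix $G$ with $P(t)=e^{tG}$ for all $t\ge0$. Matrices indexed by $S\times S$ act on functions $g:S\to\mathbb{C}$ by $(Gg)(\alpha)=\sum_{\beta\in S}G_{\alpha\beta}g(\beta)$, and $e^{t(G+iuM_f)}$ is the matrix exponential. Conditional probabilities and expectations are understood whenever the conditioning event has positive probability.
   Formalization: The process Y is additionally assumed to be jointly measurable in time and outcome (true for right-continuous paths); without some such path regularity the finite-dimensional laws do not determine the path integral and the formula can fail. *)

theory Defs
  imports "HOL-Probability.Probability"
begin

definition transition_matrix :: "real^'s^'s \<Rightarrow> bool" where
  "transition_matrix A \<longleftrightarrow> (\<forall>\<alpha> \<beta>. 0 \<le> A $ \<alpha> $ \<beta>) \<and> (\<forall>\<alpha>. (\<Sum>\<beta>\<in>UNIV. A $ \<alpha> $ \<beta>) = 1)"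

(* The finite state space is the type 's. Conditional probabilities are only constrained
   when the conditioning event has positive probability; as the library sets x / 0 = 0,
   this guard cannot be omitted. The times are listed in decreasing order
   t > \<tau> 1 > ... > \<tau> n, so \<tau> 1 is the most recent one. *)
locale continuous_time_markov_chain = prob_space M
  for M :: "'w measure"
    and Y :: "real \<Rightarrow> 'w \<Rightarrow> 's::finite"
    and P :: "real \<Rightarrow> real^'s^'s" +
  assumes measurable_state:
      "\<And>t. t \<ge> 0 \<Longrightarrow> Y t \<in> measurable M (count_space UNIV)"
    and memoryless:
      "\<And>(n::nat) (t::real) (\<tau> :: nat \<Rightarrow> real) (\<alpha> :: nat \<Rightarrow> 's) (\<beta> :: 's).
        \<lbrakk> n \<ge> 1; t > \<tau> 1; \<forall>i\<in>{1..<n}. \<tau> i > \<tau> (Suc i); \<tau> n \<ge> 0;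
          \<P>(\<omega> in M. \<forall>i\<in>{1..n}. Y (\<tau> i) \<omega> = \<alpha> i) > 0 \<rbrakk> \<Longrightarrow>
        \<P>(\<omega> in M. Y t \<omega> = \<beta> \<bar> \<forall>i\<in>{1..n}. Y (\<tau> i) \<omega> = \<alpha> i) =
        \<P>(\<omega> in M. Y t \<omega> = \<beta> \<bar> Y (\<tau> 1) \<omega> = \<alpha> 1)"
    and transition_matrix: "\<And>t. t \<ge> 0 \<Longrightarrow> transition_matrix (P t)"
    and homogeneous:
      "\<And>(s::real) (t::real) (\<alpha> :: 's) (\<beta> :: 's).
        \<lbrakk> s \<ge> 0; t \<ge> 0; \<P>(\<omega> in M. Y s \<omega> = \<alpha>) > 0 \<rbrakk> \<Longrightarrow>
        \<P>(\<omega> in M. Y (s + t) \<omega> = \<beta> \<bar> Y s \<omega> = \<alpha>) = P t $ \<alpha> $ \<beta>"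
    and P_0: "P 0 = mat 1"
    and P_continuous_at_0: "(P \<longlongrightarrow> mat 1) (at_right 0)"
    and P_semigroup: "\<And>s t. \<lbrakk> s \<ge> 0; t \<ge> 0 \<rbrakk> \<Longrightarrow> P (t + s) = P t ** P s"

(* The library has no matrix exponential for the fixed-size matrices; moreover the product and the power
   on the type vec are componentwise, so the powers below use the product of matrices. *)
definition matrix_pow :: "'a::semiring_1^'n^'n \<Rightarrow> nat \<Rightarrow> 'a^'n^'n" where
  "matrix_pow A k = ((\<lambda>B. A ** B) ^^ k) (mat 1)"

definition matrix_exp :: "'a::{real_normed_algebra_1, banach}^'n^'n \<Rightarrow> 'a^'n^'n" where
  "matrix_exp A = (\<Sum>k. inverse (fact k :: real) *\<^sub>R matrix_pow A k)"

definition infinitesimal_generator ::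
    "(real \<Rightarrow> real^'s^'s) \<Rightarrow> real^'s^'s \<Rightarrow> bool" where
  "infinitesimal_generator P G \<longleftrightarrow> (\<forall>t\<ge>0. P t = matrix_exp (t *\<^sub>R G))"

(* Joint measurability in time and \<omega>, the usual condition under which the pathwise
   integrals are well-defined random variables; it holds for instance when all paths are
   right-continuous (for the discrete topology on the state space). *)
definition measurable_process :: "'w measure \<Rightarrow> (real \<Rightarrow> 'w \<Rightarrow> 's) \<Rightarrow> bool" where
  "measurable_process M Y \<longleftrightarrow>
    (\<lambda>(t, \<omega>). Y t \<omega>) \<in> measurable (restrict_space borel {0..} \<Otimes>\<^sub>M M) (count_space UNIV)"

definition path_integral ::
    "('s \<Rightarrow> real) \<Rightarrow> (real \<Rightarrow> 'w \<Rightarrow> 's) \<Rightarrow> real \<Rightarrow> 'w \<Rightarrow> real" where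
  "path_integral f Y t \<omega> = (LINT s:{0..t}|lborel. f (Y s \<omega>))"

(* Elementary conditional expectation E(Z | A), meaningful when A has positive probability. *)
definition cond_expectation :: "'w measure \<Rightarrow> ('w \<Rightarrow> complex) \<Rightarrow> 'w set \<Rightarrow> complex" where
  "cond_expectation M Z A = (LINT \<omega>|uniform_measure M A. Z \<omega>)"

definition mult_op :: "('s \<Rightarrow> real) \<Rightarrow> complex^'s \<Rightarrow> complex^'s" where
  "mult_op f g = (\<chi> y. complex_of_real (f y) * g $ y)"

end

(* The integral X_t is replaced by Riemann sums with mesh h = t / n. Since P(r) tends to the
   identity as r decreases to 0, a state is left within time h only with small probability, so by
   Fubini the Riemann sums converge to X_t in L1, without any regularity of the paths beyond
   joint measurability. By the Markov property the characteristic function of a Riemann sum is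
   ((D_h P(h))^n 1)(y0), where D_h is multiplication by exp(i u h f). As D_h P(h) is a sup norm
   contraction with derivative G + i u M_f at h = 0, these products converge to the
   exponential, as in the Lie product formula. *)

theory Submission
  imports Defs
begin

text \<open>The contraction property comes from two facts: rows of P(h) are probability vectors, and
  the entries of D_h have modulus one. It is what makes the local errors harmless: one step misses
  the exponential curve by o(h), and n such errors add up instead of being amplified. Every error is
  therefore bounded by a multiple of \<epsilon> times the elapsed time, with the mesh chosen after
  \<epsilon>.

  Joint measurability gives no control over a single path, so nothing is estimated path by path. At
  a fixed time the increment since the last grid point is small in mean, and only then is time
  integrated.

  Conditional probabilities are turned into products such as P(A and B) = P(A) p, which remain valid
  for null events A, so that sums over all states and all discrete paths can be formed. The
  condition on the initial state is carried as an indicator until one final division.\<close>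

section \<open>Matrix exponentials as entrywise power series\<close>

lemma matrix_pow_Suc: "matrix_pow A (Suc k) = A ** matrix_pow A k"
  by (simp add: matrix_pow_def)

text \<open>The sum of all entry norms dominates every row sum, so each further factor
  \<open>A\<close> costs at most this constant. The crude geometric bound is enough for convergence
  and for uniform constants.\<close>

lemma norm_matrix_pow_component_le:
  fixes A :: "'a::real_normed_field^'n^'n"
  shows "norm (matrix_pow A k $ i $ j) \<le> (\<Sum>i\<in>UNIV. \<Sum>j\<in>UNIV. norm (A $ i $ j)) ^ k"
proof (induction k arbitrary: i)
  case 0
  show ?case by (simp add: matrix_pow_def mat_def)
next
  case (Suc k)
  let ?N = "\<Sum>i\<in>UNIV. \<Sum>j\<in>UNIV. norm (A $ i $ j)"
  have N: "0 \<le> ?N" by (intro sum_nonneg) auto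
  have "norm (matrix_pow A (Suc k) $ i $ j) = norm (\<Sum>l\<in>UNIV. A $ i $ l * matrix_pow A k $ l $ j)"
    by (simp add: matrix_pow_Suc matrix_matrix_mult_def)
  also have "\<dots> \<le> (\<Sum>l\<in>UNIV. norm (A $ i $ l) * ?N ^ k)"
    by (intro sum_norm_le) (simp add: norm_mult mult_left_mono Suc)
  also have "\<dots> = (\<Sum>l\<in>UNIV. norm (A $ i $ l)) * ?N ^ k"
    by (simp add: sum_distrib_right)
  also have "\<dots> \<le> ?N * ?N ^ k"
    by (intro mult_right_mono zero_le_power N member_le_sum[of i UNIV "\<lambda>i. \<Sum>j\<in>UNIV. norm (A $ i $ j)"])
       (auto intro: sum_nonneg)
  finally show ?case by simp
qed

lemma matrix_pow_scaleR:
  fixes A :: "'a::real_normed_field^'n^'n"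
  shows "matrix_pow (x *\<^sub>R A) k = x ^ k *\<^sub>R matrix_pow A k"
proof (induction k)
  case 0
  show ?case by (simp add: matrix_pow_def)
next
  case (Suc k)
  show ?case
    by (simp add: matrix_pow_Suc Suc matrix_matrix_mult_def vec_eq_iff scaleR_sum_right mult.commute)
qed

section \<open>Power series with coefficients c k / k! for geometrically bounded c k\<close>

lemma norm_egf_term_le:
  fixes c :: "nat \<Rightarrow> 'a::{real_normed_field,banach}"
  assumes "\<And>k. norm (c k) \<le> B * N ^ k"
  shows "norm (c k / fact k * z ^ k) \<le> B * (inverse (fact k) * (N * norm z) ^ k)"
proof -
  have "norm (c k / fact k * z ^ k) = norm (c k) * (norm z ^ k / fact k)"
    by (simp add: norm_mult norm_divide norm_power)
  also have "\<dots> \<le> B * N ^ k * (norm z ^ k / fact k)"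
    by (intro mult_right_mono assms) auto
  finally show ?thesis
    by (simp add: power_mult_distrib divide_inverse mult_ac)
qed

lemma summable_egf:
  fixes c :: "nat \<Rightarrow> 'a::{real_normed_field,banach}"
  assumes "\<And>k. norm (c k) \<le> B * N ^ k"
  shows "summable (\<lambda>k. c k / fact k * z ^ k)"
  by (rule summable_comparison_test[OF _ summable_mult[OF summable_exp]])
     (use norm_egf_term_le[of c, OF assms] in blast)

lemma norm_egf_le:
  fixes c :: "nat \<Rightarrow> 'a::{real_normed_field,banach}"
  assumes "\<And>k. norm (c k) \<le> B * N ^ k"
  shows "norm (\<Sum>k. c k / fact k * z ^ k) \<le> B * exp (N * norm z)"
proof -
  have s: "(\<lambda>k. B * (inverse (fact k) * (N * norm z) ^ k)) sums (B * exp (N * norm z))"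
    using sums_mult[OF exp_converges[of "N * norm z"], of B] by simp
  have "norm (\<Sum>k. c k / fact k * z ^ k) \<le> (\<Sum>k. B * (inverse (fact k) * (N * norm z) ^ k))"
    by (rule norm_suminf_le[OF norm_egf_term_le[of c, OF assms] sums_summable[OF s]])
  with sums_unique[OF s] show ?thesis by simp
qed

text \<open>Division by \<open>fact k\<close> turns differentiation into a shift of
  \<open>c\<close>. The shifted sequence is again geometrically bounded, so the rule can be
  iterated.\<close>

lemma has_field_derivative_egf:
  fixes c :: "nat \<Rightarrow> 'a::{real_normed_field,banach}"
  assumes "\<And>k. norm (c k) \<le> B * N ^ k"
  shows "((\<lambda>z. \<Sum>k. c k / fact k * z ^ k) has_field_derivative (\<Sum>k. c (Suc k) / fact k * z ^ k)) (at z)"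
proof -
  have "diffs (\<lambda>k. c k / fact k) = (\<lambda>k. c (Suc k) / fact k)"
    by (simp add: diffs_def fun_eq_iff del: of_nat_Suc)
  then show ?thesis
    using termdiffs_strong_converges_everywhere[OF summable_egf[of c, OF assms], of z] by simp
qed

section \<open>Series of vectors and matrices, entry by entry\<close>

lemma summable_vecI:
  fixes F :: "nat \<Rightarrow> 'a::real_normed_vector^'n"
  assumes "\<And>i. summable (\<lambda>k. F k $ i)"
  shows "summable F"
proof -
  have "F sums (\<chi> i. \<Sum>k. F k $ i)"
    unfolding sums_def
    by (rule vec_tendstoI) (use assms in \<open>simp add: summable_LIMSEQ\<close>)
  then show ?thesis by (rule sums_summable)
qed

lemma suminf_vec_component:
  fixes F :: "nat \<Rightarrow> 'a::real_normed_vector^'n"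
  assumes "summable F"
  shows "suminf F $ i = (\<Sum>k. F k $ i)"
  by (rule sums_unique) (use bounded_linear.sums[OF bounded_linear_vec_nth summable_sums[OF assms]] in simp)

text \<open>Separating the real factor \<open>x\<close> from \<open>A\<close> makes each entry a
  scalar power series in \<open>x\<close>, to which the estimates above apply.\<close>

lemma matrix_exp_component:
  fixes A :: "'a::{real_normed_field,banach}^'n^'n"
  shows "matrix_exp (x *\<^sub>R A) $ i $ j = (\<Sum>k. matrix_pow A k $ i $ j / fact k * of_real x ^ k)"
proof -
  let ?F = "\<lambda>k. inverse (fact k :: real) *\<^sub>R matrix_pow (x *\<^sub>R A) k"
  have F: "?F k $ i $ j = matrix_pow A k $ i $ j / fact k * of_real x ^ k" for i j k
    unfolding matrix_pow_scaleR vector_scaleR_component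
    by (simp add: scaleR_conv_of_real[where 'a='a] divide_inverse mult_ac)
  have "summable (\<lambda>k. ?F k $ i $ j)" for i j
    unfolding F
    by (rule summable_egf[of _ 1]) (use norm_matrix_pow_component_le[of A] in simp)
  \<comment> \<open>A matrix is a vector of rows: summability is lifted from entries to rows, then
    from rows to the matrix.\<close>
  then have s: "summable (\<lambda>k. ?F k $ i)" for i
    by (intro summable_vecI) auto
  then have "summable ?F" by (rule summable_vecI)
  from suminf_vec_component[OF this] suminf_vec_component[OF s]
  show ?thesis
    unfolding matrix_exp_def F[symmetric] by simp
qed

lemma norm_matrix_pow_mult_vec_component_le:
  fixes K :: "'a::real_normed_field^'n^'n"
  shows "norm ((matrix_pow K k *v v) $ i)
    \<le> (\<Sum>j\<in>UNIV. norm (v $ j)) * (\<Sum>i\<in>UNIV. \<Sum>j\<in>UNIV. norm (K $ i $ j)) ^ k"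
  unfolding matrix_vector_mult_def vec_lambda_beta sum_distrib_right
  by (intro sum_norm_le)
     (use norm_matrix_pow_component_le[of K k i] in \<open>simp add: norm_mult mult.commute mult_left_mono\<close>)

lemma matrix_exp_mult_vec_component:
  fixes K :: "'a::{real_normed_field,banach}^'n^'n"
  shows "(matrix_exp (x *\<^sub>R K) *v v) $ i = (\<Sum>k. (matrix_pow K k *v v) $ i / fact k * of_real x ^ k)"
proof -
  have s: "summable (\<lambda>k. matrix_pow K k $ i $ j / fact k * of_real x ^ k)" for j
    by (rule summable_egf[of _ 1]) (use norm_matrix_pow_component_le[of K] in simp)
  have "(matrix_exp (x *\<^sub>R K) *v v) $ i
      = (\<Sum>j\<in>UNIV. \<Sum>k. matrix_pow K k $ i $ j / fact k * of_real x ^ k * v $ j)"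
    using suminf_mult2[OF s] by (simp add: matrix_vector_mult_def matrix_exp_component)
  also have "\<dots> = (\<Sum>k. \<Sum>j\<in>UNIV. matrix_pow K k $ i $ j / fact k * of_real x ^ k * v $ j)"
    by (rule suminf_sum[symmetric]) (use summable_mult2[OF s] in blast)
  also have "\<dots> = (\<Sum>k. (matrix_pow K k *v v) $ i / fact k * of_real x ^ k)"
    by (intro suminf_cong) (simp add: matrix_vector_mult_def sum_distrib_left sum_divide_distrib mult_ac)
  finally show ?thesis .
qed

lemma matrix_exp_zero_mult_vec:
  fixes K :: "'a::{real_normed_field,banach}^'n^'n"
  shows "matrix_exp (0 *\<^sub>R K) *v v = v"
  unfolding vec_eq_iff matrix_exp_mult_vec_component of_real_0 powser_zero
  by (simp add: matrix_pow_def)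

lemma norm_matrix_exp_mult_vec_component_le:
  fixes K :: "'a::{real_normed_field,banach}^'n^'n"
  assumes "\<bar>x\<bar> \<le> t"
  shows "norm ((matrix_exp (x *\<^sub>R K) *v v) $ i)
    \<le> (\<Sum>j\<in>UNIV. norm (v $ j)) * exp ((\<Sum>i\<in>UNIV. \<Sum>j\<in>UNIV. norm (K $ i $ j)) * t)"
proof -
  let ?N = "\<Sum>i\<in>UNIV. \<Sum>j\<in>UNIV. norm (K $ i $ j)" and ?V = "\<Sum>j\<in>UNIV. norm (v $ j)"
  have "norm ((matrix_exp (x *\<^sub>R K) *v v) $ i) \<le> ?V * exp (?N * norm (of_real x :: 'a))"
    unfolding matrix_exp_mult_vec_component
    by (rule norm_egf_le[OF norm_matrix_pow_mult_vec_component_le])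
  also have "\<dots> \<le> ?V * exp (?N * t)"
    using assms by (auto intro!: mult_left_mono sum_nonneg)
  finally show ?thesis .
qed

text \<open>Only the coefficient of degree one survives at 0. The series is differentiated over the
  field \<open>'a\<close> and then restricted to the real line, which serves real and complex
  matrices alike.\<close>

lemma matrix_exp_component_has_derivative_at_0:
  fixes A :: "'a::{real_normed_field,banach}^'n^'n"
  shows "((\<lambda>x. matrix_exp (x *\<^sub>R A) $ i $ j) has_vector_derivative A $ i $ j) (at 0)"
proof -
  have "norm (matrix_pow A k $ i $ j) \<le> 1 * (\<Sum>i\<in>UNIV. \<Sum>j\<in>UNIV. norm (A $ i $ j)) ^ k" for k
    using norm_matrix_pow_component_le[of A] by simp
  from has_field_derivative_egf[of "\<lambda>k. matrix_pow A k $ i $ j", OF this, of 0]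
  have "((\<lambda>z. \<Sum>k. matrix_pow A k $ i $ j / fact k * z ^ k) has_field_derivative A $ i $ j) (at (of_real 0))"
    unfolding powser_zero by (simp add: matrix_pow_def)
  then show ?thesis
    unfolding matrix_exp_component by (rule has_vector_derivative_real_field)
qed

section \<open>A product formula\<close>

text \<open>The curve w(s) = exp(s K) v solves w' = K w, so the subtracted terms form its first
  order Taylor polynomial at \<open>s\<close>. One constant \<open>C\<close> serves all coordinates
  and all steps within the time horizon \<open>t\<close>.\<close>

lemma matrix_exp_mult_vec_second_order:
  fixes K :: "complex^'n^'n" and v :: "complex^'n"
  obtains C where "C \<ge> 0"
    "\<And>s h i. 0 \<le> s \<Longrightarrow> 0 \<le> h \<Longrightarrow> s + h \<le> t \<Longrightarrow>
      norm ((matrix_exp ((s + h) *\<^sub>R K) *v v) $ i - (matrix_exp (s *\<^sub>R K) *v v) $ i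
            - of_real h * (K *v (matrix_exp (s *\<^sub>R K) *v v)) $ i) \<le> C * h\<^sup>2"
proof
  let ?N = "\<Sum>i\<in>UNIV. \<Sum>j\<in>UNIV. norm (K $ i $ j)" and ?V = "\<Sum>j\<in>UNIV. norm (v $ j)"
  \<comment> \<open>A bound for the second derivative on the disc of radius \<open>t\<close>; the
    two differentiations contribute \<open>?N ^ 2\<close>.\<close>
  define C where "C = ?V * ?N ^ 2 * exp (?N * t)"
  show "C \<ge> 0" by (auto simp: C_def intro!: mult_nonneg_nonneg sum_nonneg)
  fix s h :: real and i :: 'n
  assume sh: "0 \<le> s" "0 \<le> h" "s + h \<le> t"
  define c where "c = (\<lambda>i k. (matrix_pow K k *v v) $ i)"
  \<comment> \<open>\<open>w i m\<close> is the m-th derivative of coordinate \<open>i\<close>,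
    extended to complex arguments for the complex Taylor theorem; each differentiation shifts the
    coefficients by one.\<close>
  define w where "w = (\<lambda>i m (z::complex). \<Sum>k. c i (k + m) / fact k * z ^ k)"
  have c_le: "norm (c i (k + m)) \<le> ?V * ?N ^ m * ?N ^ k" for i k m
    using norm_matrix_pow_mult_vec_component_le[of K "k + m" v i]
    by (simp add: c_def power_add mult_ac)
  have w0: "w i 0 (of_real s) = (matrix_exp (s *\<^sub>R K) *v v) $ i" for i s
    by (simp add: w_def c_def matrix_exp_mult_vec_component)
  have c_Suc: "c i (Suc k) = (\<Sum>j\<in>UNIV. K $ i $ j * c j k)" for i k
    unfolding c_def matrix_pow_Suc matrix_vector_mul_assoc[symmetric]
    by (simp add: matrix_vector_mult_def[of K])
  \<comment> \<open>The differential equation w' = K w, read off from the coefficient recursion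
    \<open>c_Suc\<close>.\<close>
  have w1: "w i 1 z = (\<Sum>j\<in>UNIV. K $ i $ j * w j 0 z)" for i z
  proof -
    have s: "summable (\<lambda>k. c j k / fact k * z ^ k)" for j
      using summable_egf[OF c_le[of j _ 0]] by simp
    have "w i 1 z = (\<Sum>k. \<Sum>j\<in>UNIV. K $ i $ j * (c j k / fact k * z ^ k))"
      unfolding w_def
      by (intro suminf_cong) (simp add: c_Suc sum_distrib_left sum_divide_distrib mult_ac)
    also have "\<dots> = (\<Sum>j\<in>UNIV. \<Sum>k. K $ i $ j * (c j k / fact k * z ^ k))"
      by (rule suminf_sum) (use summable_mult[OF s] in blast)
    also have "\<dots> = (\<Sum>j\<in>UNIV. K $ i $ j * w j 0 z)"
      using suminf_mult[OF s] by (simp add: w_def)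
    finally show ?thesis .
  qed
  have deriv: "(w i m has_field_derivative w i (Suc m) z) (at z within S)" for m z S
    using has_field_derivative_egf[OF c_le[of i _ m], of z]
    unfolding w_def by (auto intro: has_field_derivative_at_within)
  have bound: "norm (w i (Suc 1) z) \<le> C" if "z \<in> cball 0 t" for z
  proof -
    have "norm (w i (Suc 1) z) \<le> ?V * ?N ^ Suc 1 * exp (?N * norm z)"
      unfolding w_def by (rule norm_egf_le[OF c_le])
    also have "\<dots> \<le> ?V * ?N ^ Suc 1 * exp (?N * t)"
      using that by (intro mult_left_mono) (auto intro!: mult_left_mono mult_nonneg_nonneg sum_nonneg)
    finally show ?thesis by (simp add: C_def numeral_2_eq_2)
  qed
  have "norm (w i 0 (of_real (s + h)) - (\<Sum>m\<le>1. w i m (of_real s) * (of_real (s + h) - of_real s) ^ m / fact m))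
      \<le> C * norm (of_real (s + h) - of_real s :: complex) ^ Suc 1 / fact 1"
  proof (rule complex_Taylor)
    show "convex (cball (0::complex) t)" by simp
  qed (use deriv bound sh in \<open>auto simp: norm_of_real simp del: of_real_add\<close>)
  then show "norm ((matrix_exp ((s + h) *\<^sub>R K) *v v) $ i - (matrix_exp (s *\<^sub>R K) *v v) $ i
            - of_real h * (K *v (matrix_exp (s *\<^sub>R K) *v v)) $ i) \<le> C * h\<^sup>2"
    using sh
    by (simp add: w1[unfolded One_nat_def] w0 matrix_vector_mult_def[of K] numeral_2_eq_2 mult_ac diff_diff_eq
             del: of_real_add flip: of_real_diff)
qed

text \<open>Consistency plus stability: a single step with \<open>A h\<close> misses the exponential
  curve by at most \<open>\<epsilon> * h\<close>, and earlier errors are carried along without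
  growing. A bound linear in the elapsed time is what the induction on \<open>n\<close> preserves,
  with \<open>\<delta>\<close> independent of \<open>n\<close>.\<close>

lemma matrix_product_formula:
  fixes A :: "real \<Rightarrow> complex^'n^'n"
  assumes A0: "A 0 = mat 1"
    and deriv: "\<And>i j. ((\<lambda>h. A h $ i $ j) has_vector_derivative K $ i $ j) (at 0)"
    and contraction: "\<And>h x c i. 0 \<le> h \<Longrightarrow> (\<And>j. norm (x $ j) \<le> c) \<Longrightarrow> norm ((A h *v x) $ i) \<le> c"
    and "\<epsilon> > 0"
  obtains \<delta> where "\<delta> > 0"
    "\<And>h n i. 0 \<le> h \<Longrightarrow> h < \<delta> \<Longrightarrow> real n * h \<le> t \<Longrightarrow>
       norm ((((*v) (A h) ^^ n) v) $ i - (matrix_exp ((real n * h) *\<^sub>R K) *v v) $ i) \<le> \<epsilon> * (real n * h)"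
proof -
  define w where "w = (\<lambda>s. matrix_exp (s *\<^sub>R K) *v v)"
  define W where "W = (\<Sum>j\<in>UNIV. norm (v $ j)) * exp ((\<Sum>i\<in>UNIV. \<Sum>j\<in>UNIV. norm (K $ i $ j)) * t)"
  have W: "norm (w s $ j) \<le> W" if "0 \<le> s" "s \<le> t" for s j
    unfolding w_def W_def by (rule norm_matrix_exp_mult_vec_component_le) (use that in simp)
  have W0: "W \<ge> 0" by (auto simp: W_def intro!: mult_nonneg_nonneg sum_nonneg)
  obtain C where C: "C \<ge> 0"
    "\<And>s h i. 0 \<le> s \<Longrightarrow> 0 \<le> h \<Longrightarrow> s + h \<le> t \<Longrightarrow>
      norm (w (s + h) $ i - w s $ i - of_real h * (K *v w s) $ i) \<le> C * h\<^sup>2"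
    using matrix_exp_mult_vec_second_order[of t K v] unfolding w_def by metis
  \<comment> \<open>Each entry of a row will contribute \<open>\<eta> * h * W\<close>; this choice
    keeps the row total below \<open>\<epsilon> / 2 * h\<close>. The added 1 keeps the denominator
    positive when \<open>W\<close> vanishes.\<close>
  define \<eta> where "\<eta> = \<epsilon> / (2 * (CARD('n) * W + 1))"
  have "\<epsilon> * x / (2 * (x + 1)) \<le> \<epsilon> / 2" "0 < \<epsilon> / (2 * (x + 1))" if "x \<ge> 0" for x
    using that \<open>\<epsilon> > 0\<close> by (simp_all add: field_simps)
  from this[of "CARD('n) * W"] W0 have \<eta>: "\<eta> > 0" "CARD('n) * \<eta> * W \<le> \<epsilon> / 2"
    by (simp_all add: \<eta>_def mult_ac)
  have "\<exists>d>0. \<forall>h. norm h < d \<longrightarrow> norm (A h $ i $ j - A 0 $ i $ j - h *\<^sub>R K $ i $ j) \<le> \<eta> * norm h" for i j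
    using deriv[of i j] \<eta>(1) by (simp add: has_vector_derivative_def has_derivative_at_alt)
  then obtain d where d: "\<And>i j. d i j > 0"
    "\<And>i j h. norm h < d i j \<Longrightarrow> norm (A h $ i $ j - A 0 $ i $ j - h *\<^sub>R K $ i $ j) \<le> \<eta> * norm h"
    by metis
  \<comment> \<open>The first bound yields \<open>C * h \<le> \<epsilon> / 2\<close> for the Taylor
    remainder; the second is at most each of the finitely many radii \<open>d i j\<close>.\<close>
  define \<delta> where "\<delta> = min (\<epsilon> / (2 * (C + 1))) (Min (range (\<lambda>(i, j). d i j)))"
  have "\<delta> > 0" using d(1) \<open>\<epsilon> > 0\<close> C(1) by (auto simp: \<delta>_def)
  have \<delta>_d: "\<delta> \<le> d i j" for i j
    unfolding \<delta>_def by (rule min.coboundedI2, rule Min_le) auto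
  have step: "norm (w (s + h) $ i - (A h *v w s) $ i) \<le> \<epsilon> * h"
    if "0 \<le> s" "0 \<le> h" "h < \<delta>" "s + h \<le> t" for s h i
  proof -
    define D where "D = (\<lambda>j. A h $ i $ j - A 0 $ i $ j - h *\<^sub>R K $ i $ j)"
    have "w s $ i = (\<Sum>j\<in>UNIV. A 0 $ i $ j * w s $ j)"
      using matrix_vector_mul_lid[of "w s"] unfolding A0[symmetric]
      by (metis (no_types) matrix_vector_mult_def vec_lambda_beta)
    then have eq: "(A h *v w s) $ i = w s $ i + of_real h * (K *v w s) $ i + (\<Sum>j\<in>UNIV. D j * w s $ j)"
      by (simp add: D_def matrix_vector_mult_def algebra_simps scaleR_conv_of_real
          sum_distrib_left flip: sum.distrib sum_subtractf)
    have "norm (\<Sum>j\<in>UNIV. D j * w s $ j) \<le> (\<Sum>j\<in>(UNIV :: 'n set). \<eta> * h * W)"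
    proof (intro sum_norm_le)
      fix j
      have "norm (D j) \<le> \<eta> * h"
        using d(2)[of h i j] \<delta>_d[of i j] that by (simp add: D_def)
      then show "norm (D j * w s $ j) \<le> \<eta> * h * W"
        using W[of s j] that \<eta>(1) by (simp add: norm_mult mult_mono)
    qed
    also have "\<dots> = CARD('n) * \<eta> * W * h" by simp
    also have "\<dots> \<le> \<epsilon> / 2 * h" using \<eta>(2) that by (intro mult_right_mono) auto
    finally have 1: "norm (\<Sum>j\<in>UNIV. D j * w s $ j) \<le> \<epsilon> / 2 * h" .
    have "h \<le> \<epsilon> / (2 * (C + 1))" using that by (simp add: \<delta>_def)
    then have "C * h \<le> \<epsilon> / 2"
      using C(1) that by (auto simp: field_simps)
    then have "C * h * h \<le> \<epsilon> / 2 * h" using that by (intro mult_right_mono) auto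
    then have 2: "C * h\<^sup>2 \<le> \<epsilon> / 2 * h" by (simp add: power2_eq_square mult_ac)
    have "w (s + h) $ i - (A h *v w s) $ i
        = (w (s + h) $ i - w s $ i - of_real h * (K *v w s) $ i) - (\<Sum>j\<in>UNIV. D j * w s $ j)"
      by (simp add: eq)
    also have "norm \<dots> \<le> C * h\<^sup>2 + \<epsilon> / 2 * h"
      using C(2)[of s h i] 1 that by (intro order_trans[OF norm_triangle_ineq4 add_mono]) auto
    finally show ?thesis using 2 by (simp add: field_simps)
  qed
  have main: "norm ((((*v) (A h) ^^ n) v) $ i - w (real n * h) $ i) \<le> \<epsilon> * (real n * h)"
    if "0 \<le> h" "h < \<delta>" "real n * h \<le> t" for h n i
    using that(3)
  proof (induction n arbitrary: i)
    case 0
    show ?case by (simp add: w_def matrix_exp_zero_mult_vec[simplified])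
  next
    case (Suc n)
    have Suc_h: "real (Suc n) * h = real n * h + h" by (simp add: algebra_simps)
    have le: "real n * h \<le> t" using Suc.prems that(1) unfolding Suc_h by simp
    let ?x = "((*v) (A h) ^^ n) v"
    \<comment> \<open>Stability: the contraction is applied with the accumulated error as its sup
      norm bound.\<close>
    have "norm ((A h *v (?x - w (real n * h))) $ i) \<le> \<epsilon> * (real n * h)"
      using contraction[OF that(1), of "?x - w (real n * h)"] Suc.IH[OF le] by simp
    moreover have "norm (w (real n * h + h) $ i - (A h *v w (real n * h)) $ i) \<le> \<epsilon> * h"
      using step[of "real n * h" h i] Suc.prems that unfolding Suc_h by simp
    moreover have "(((*v) (A h) ^^ Suc n) v) $ i - w (real (Suc n) * h) $ i
      = (A h *v (?x - w (real n * h))) $ i - (w (real n * h + h) $ i - (A h *v w (real n * h)) $ i)"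
      unfolding Suc_h by (simp add: matrix_vector_mult_diff_distrib)
    ultimately have "norm ((((*v) (A h) ^^ Suc n) v) $ i - w (real (Suc n) * h) $ i) \<le> \<epsilon> * (real n * h) + \<epsilon> * h"
      by (simp only:) (rule order_trans[OF norm_triangle_ineq4 add_mono])
    then show ?case by (simp add: Suc_h algebra_simps)
  qed
  show ?thesis
    using that[OF \<open>\<delta> > 0\<close>] main unfolding w_def by blast
qed

section \<open>Functionals of a discrete skeleton of the chain\<close>

text \<open>The integrand is a finite combination of indicators of level sets of \<open>X\<close>.
  Measurability enters through these level sets alone, which suits values such as whole discrete
  paths.\<close>

lemma (in prob_space) integral_finite_range:
  fixes \<phi> :: "'b \<Rightarrow> complex"
  assumes "finite S" "\<And>\<omega>. \<omega> \<in> space M \<Longrightarrow> X \<omega> \<in> S"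
    and ev: "\<And>a. a \<in> S \<Longrightarrow> {\<omega> \<in> space M. X \<omega> = a} \<in> events"
  shows "(LINT \<omega>|M. \<phi> (X \<omega>)) = (\<Sum>a\<in>S. \<phi> a * of_real (prob {\<omega> \<in> space M. X \<omega> = a}))"
proof -
  have "(LINT \<omega>|M. \<phi> (X \<omega>)) = (LINT \<omega>|M. (\<Sum>a\<in>S. \<phi> a * of_real (indicator {\<omega> \<in> space M. X \<omega> = a} \<omega>)))"
  proof (rule Bochner_Integration.integral_cong[OF refl])
    fix \<omega> assume "\<omega> \<in> space M"
    then have "(\<Sum>a\<in>S. \<phi> a * of_real (indicator {\<omega> \<in> space M. X \<omega> = a} \<omega>)) = (\<Sum>a\<in>S. if a = X \<omega> then \<phi> a else 0)"
      by (intro sum.cong) (auto simp: indicator_def)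
    also have "\<dots> = \<phi> (X \<omega>)"
      using assms(1,2) \<open>\<omega> \<in> space M\<close> by (simp add: sum.delta')
    finally show "\<phi> (X \<omega>) = (\<Sum>a\<in>S. \<phi> a * of_real (indicator {\<omega> \<in> space M. X \<omega> = a} \<omega>))" by simp
  qed
  also have "\<dots> = (\<Sum>a\<in>S. LINT \<omega>|M. \<phi> a * of_real (indicator {\<omega> \<in> space M. X \<omega> = a} \<omega>))"
    by (rule Bochner_Integration.integral_sum)
       (use ev in \<open>auto intro!: integrable_mult_right integrable_of_real integrable_real_indicator simp: emeasure_eq_measure\<close>)
  also have "\<dots> = (\<Sum>a\<in>S. \<phi> a * of_real (prob {\<omega> \<in> space M. X \<omega> = a}))"
    by (intro sum.cong refl) (simp add: ev)
  finally show ?thesis .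
qed

context continuous_time_markov_chain
begin

lemma state_event [measurable]:
  "t \<ge> 0 \<Longrightarrow> Measurable.pred M (\<lambda>\<omega>. Y t \<omega> = \<alpha>)"
  using measurable_state[of t] by measurable

text \<open>In product form the transition law also covers states of probability zero, where both
  sides vanish and \<open>homogeneous\<close> says nothing.\<close>

lemma prob_transition:
  assumes "s \<ge> 0" "r \<ge> 0"
  shows "\<P>(\<omega> in M. Y (s + r) \<omega> = \<beta> \<and> Y s \<omega> = \<alpha>) = \<P>(\<omega> in M. Y s \<omega> = \<alpha>) * P r $ \<alpha> $ \<beta>"
proof (cases "\<P>(\<omega> in M. Y s \<omega> = \<alpha>) > 0")
  case True
  from homogeneous[OF assms True, of \<beta>] True show ?thesis
    by (simp add: cond_prob_def field_simps)
next
  case False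
  then have "\<P>(\<omega> in M. Y s \<omega> = \<alpha>) = 0"
    by (simp add: zero_less_measure_iff)
  moreover have "\<P>(\<omega> in M. Y (s + r) \<omega> = \<beta> \<and> Y s \<omega> = \<alpha>) \<le> \<P>(\<omega> in M. Y s \<omega> = \<alpha>)"
    using assms by (intro finite_measure_mono) auto
  ultimately show ?thesis
    by (simp add: measure_le_0_iff)
qed

text \<open>\<open>memoryless\<close> reduces the history to its latest state and
  \<open>homogeneous\<close> supplies the transition probability; the product form again includes
  null histories.\<close>

lemma prob_path_Suc:
  assumes "h > 0"
  shows "\<P>(\<omega> in M. Y (real (Suc n) * h) \<omega> = \<beta> \<and> (\<forall>k\<le>n. Y (real k * h) \<omega> = a k))
    = \<P>(\<omega> in M. \<forall>k\<le>n. Y (real k * h) \<omega> = a k) * P h $ a n $ \<beta>"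
proof (cases "\<P>(\<omega> in M. \<forall>k\<le>n. Y (real k * h) \<omega> = a k) > 0")
  case True
  \<comment> \<open>\<open>memoryless\<close> lists times in decreasing order from index 1, so the
    grid is reversed: \<open>\<tau> 1\<close> is the present time n h and
    \<open>\<tau> (Suc n)\<close> is 0.\<close>
  define \<tau> where "\<tau> = (\<lambda>i. real (Suc n - i) * h)"
  define \<alpha> where "\<alpha> = (\<lambda>i. a (Suc n - i))"
  have path: "(\<forall>i\<in>{1..Suc n}. Y (\<tau> i) \<omega> = \<alpha> i) \<longleftrightarrow> (\<forall>k\<le>n. Y (real k * h) \<omega> = a k)" for \<omega>
  proof
    assume L: "\<forall>i\<in>{1..Suc n}. Y (\<tau> i) \<omega> = \<alpha> i"
    show "\<forall>k\<le>n. Y (real k * h) \<omega> = a k"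
    proof (intro allI impI)
      fix k assume "k \<le> n"
      then show "Y (real k * h) \<omega> = a k"
        using bspec[OF L, of "Suc n - k"] by (simp add: \<tau>_def \<alpha>_def)
    qed
  next
    assume R: "\<forall>k\<le>n. Y (real k * h) \<omega> = a k"
    show "\<forall>i\<in>{1..Suc n}. Y (\<tau> i) \<omega> = \<alpha> i"
    proof
      fix i assume "i \<in> {1..Suc n}"
      then have "Suc n - i \<le> n" by auto
      with R show "Y (\<tau> i) \<omega> = \<alpha> i" unfolding \<tau>_def \<alpha>_def by blast
    qed
  qed
  have end1: "\<tau> 1 = real n * h" "\<alpha> 1 = a n" by (auto simp: \<tau>_def \<alpha>_def)
  have "0 < \<P>(\<omega> in M. Y (real n * h) \<omega> = a n)"
    by (rule less_le_trans[OF True finite_measure_mono]) (use assms in auto)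
  then have hom: "\<P>(\<omega> in M. Y (real (Suc n) * h) \<omega> = \<beta> \<bar> Y (real n * h) \<omega> = a n) = P h $ a n $ \<beta>"
    using homogeneous[of "real n * h" h "a n" \<beta>] assms by (simp add: algebra_simps)
  have "\<P>(\<omega> in M. Y (real (Suc n) * h) \<omega> = \<beta> \<bar> \<forall>i\<in>{1..Suc n}. Y (\<tau> i) \<omega> = \<alpha> i) =
        \<P>(\<omega> in M. Y (real (Suc n) * h) \<omega> = \<beta> \<bar> Y (\<tau> 1) \<omega> = \<alpha> 1)"
  proof (rule memoryless)
    show "\<forall>i\<in>{1..<Suc n}. \<tau> (Suc i) < \<tau> i"
      using assms by (auto simp: \<tau>_def of_nat_diff)
    show "0 < \<P>(\<omega> in M. \<forall>i\<in>{1..Suc n}. Y (\<tau> i) \<omega> = \<alpha> i)"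
      unfolding path by (rule True)
  qed (use assms in \<open>auto simp: \<tau>_def\<close>)
  with True show ?thesis
    unfolding path end1 hom by (simp add: cond_prob_def field_simps)
next
  case False
  then have "\<P>(\<omega> in M. \<forall>k\<le>n. Y (real k * h) \<omega> = a k) = 0"
    by (simp add: zero_less_measure_iff)
  moreover have "\<P>(\<omega> in M. Y (real (Suc n) * h) \<omega> = \<beta> \<and> (\<forall>k\<le>n. Y (real k * h) \<omega> = a k))
      \<le> \<P>(\<omega> in M. \<forall>k\<le>n. Y (real k * h) \<omega> = a k)"
    using assms by (intro finite_measure_mono) auto
  ultimately show ?thesis
    by (simp add: measure_le_0_iff)
qed

text \<open>The Markov property for functionals: integrating out the newest state turns
  \<open>g\<close> into P(h) g, evaluated one step earlier. \<open>F\<close> can be arbitrary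
  because the history takes finitely many values.\<close>

lemma integral_path_Suc:
  fixes F :: "(nat \<Rightarrow> 's) \<Rightarrow> complex" and g :: "complex^'s"
  assumes "h > 0"
  shows "(LINT \<omega>|M. F (\<lambda>k\<in>{..n}. Y (real k * h) \<omega>) * g $ Y (real (Suc n) * h) \<omega>)
    = (LINT \<omega>|M. F (\<lambda>k\<in>{..n}. Y (real k * h) \<omega>) * (map_matrix of_real (P h) *v g) $ Y (real n * h) \<omega>)"
proof -
  define X where "X = (\<lambda>\<omega>. \<lambda>k\<in>{..n}. Y (real k * h) \<omega>)"
  \<comment> \<open>Restricted to \<open>{..n}\<close>, paths become extensional functions, of which
    there are finitely many.\<close>
  define S where "S = ({..n} \<rightarrow>\<^sub>E (UNIV :: 's set))"
  have S: "finite S" by (auto simp: S_def intro!: finite_PiE)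
  have X: "X \<omega> \<in> S" for \<omega> by (auto simp: X_def S_def)
  have X_eq: "X \<omega> = a \<longleftrightarrow> (\<forall>k\<le>n. Y (real k * h) \<omega> = a k)" if "a \<in> S" for a \<omega>
    using that by (auto simp: X_def S_def fun_eq_iff restrict_def PiE_def extensional_def)
  have [measurable]: "Measurable.pred M (\<lambda>\<omega>. Y (real k * h) \<omega> = \<alpha>)" for k \<alpha>
    by (rule state_event) (use assms in simp)
  have ev: "{\<omega> \<in> space M. X \<omega> = a} \<in> events" if "a \<in> S" for a
    unfolding X_eq[OF that] by measurable
  have ev2: "{\<omega> \<in> space M. (X \<omega>, Y (real (Suc n) * h) \<omega>) = b} \<in> events" if "b \<in> S \<times> UNIV" for b
  proof (cases b)
    case (Pair a \<beta>)
    then have "a \<in> S" using that by simp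
    show ?thesis
      unfolding Pair prod.inject X_eq[OF \<open>a \<in> S\<close>] by measurable
  qed
  have prob: "prob {\<omega> \<in> space M. (X \<omega>, Y (real (Suc n) * h) \<omega>) = (a, \<beta>)}
      = prob {\<omega> \<in> space M. X \<omega> = a} * P h $ a n $ \<beta>" if "a \<in> S" for a \<beta>
    using prob_path_Suc[OF assms, of n \<beta> a] unfolding prod.inject X_eq[OF that] by (simp add: conj_commute)
  have "(LINT \<omega>|M. (\<lambda>(a, \<beta>). F a * g $ \<beta>) (X \<omega>, Y (real (Suc n) * h) \<omega>))
      = (\<Sum>b\<in>S \<times> UNIV. (\<lambda>(a, \<beta>). F a * g $ \<beta>) b
          * of_real (prob {\<omega> \<in> space M. (X \<omega>, Y (real (Suc n) * h) \<omega>) = b}))"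
    by (rule integral_finite_range[OF _ _ ev2]) (use S X in auto)
  also have "\<dots> = (\<Sum>a\<in>S. \<Sum>\<beta>\<in>UNIV. F a * g $ \<beta> * of_real (prob {\<omega> \<in> space M. X \<omega> = a} * P h $ a n $ \<beta>))"
  proof (unfold sum.cartesian_product, rule sum.cong[OF refl])
    fix b assume "b \<in> S \<times> (UNIV :: 's set)"
    then obtain a \<beta> where "b = (a, \<beta>)" "a \<in> S" by auto
    then show "(\<lambda>(a, \<beta>). F a * g $ \<beta>) b * of_real (prob {\<omega> \<in> space M. (X \<omega>, Y (real (Suc n) * h) \<omega>) = b})
        = (case b of (a, \<beta>) \<Rightarrow> F a * g $ \<beta> * complex_of_real (prob {\<omega> \<in> space M. X \<omega> = a} * P h $ a n $ \<beta>))"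
      by (simp only: prod.case prob)
  qed
  also have "\<dots> = (\<Sum>a\<in>S. F a * (map_matrix of_real (P h) *v g) $ a n * of_real (prob {\<omega> \<in> space M. X \<omega> = a}))"
    by (simp add: matrix_vector_mult_def sum_distrib_left sum_distrib_right mult_ac)
  also have "\<dots> = (LINT \<omega>|M. F (X \<omega>) * (map_matrix of_real (P h) *v g) $ X \<omega> n)"
    by (rule integral_finite_range[symmetric, where \<phi> = "\<lambda>a. F a * (map_matrix of_real (P h) *v g) $ a n"])
       (use S X ev in auto)
  finally show ?thesis by (simp only: X_def prod.case restrict_apply' atMost_iff order_refl)
qed

text \<open>The induction removes the latest step: \<open>g\<close> becomes P(h) g, and the phase of
  the last summand completes this to \<open>A *v g\<close>. The induction hypothesis is thus needed
  for another function, whence the arbitrary \<open>g\<close>.\<close>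

lemma integral_riemann_sum_exp:
  fixes f :: "'s \<Rightarrow> real" and u :: real and g :: "complex^'s"
  assumes "h > 0"
  defines "A \<equiv> (\<chi> \<alpha> \<beta>. cis (u * h * f \<alpha>) * of_real (P h $ \<alpha> $ \<beta>))"
  shows "(LINT \<omega>|M. indicator {\<omega> \<in> space M. Y 0 \<omega> = y0} \<omega>
             * cis (u * (h * (\<Sum>k<n. f (Y (real k * h) \<omega>)))) * g $ Y (real n * h) \<omega>)
    = of_real (prob {\<omega> \<in> space M. Y 0 \<omega> = y0}) * ((((*v) A) ^^ n) g) $ y0"
proof (induction n arbitrary: g)
  case 0
  have ev: "{\<omega> \<in> space M. Y 0 \<omega> = y0} \<in> events" by measurable
  have "(LINT \<omega>|M. indicator {\<omega> \<in> space M. Y 0 \<omega> = y0} \<omega> * g $ Y 0 \<omega>)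
      = (LINT \<omega>|M. g $ y0 * of_real (indicator {\<omega> \<in> space M. Y 0 \<omega> = y0} \<omega>))"
    by (intro Bochner_Integration.integral_cong) (auto simp: indicator_def)
  also have "\<dots> = of_real (prob {\<omega> \<in> space M. Y 0 \<omega> = y0}) * g $ y0"
    using ev by simp
  finally show ?case by simp
next
  case (Suc n)
  \<comment> \<open>The sum uses left endpoints and stops at k = n, so the phase depends only on the
    history up to time n h, as \<open>integral_path_Suc\<close> demands.\<close>
  define F where "F = (\<lambda>a. (if a 0 = y0 then 1 else 0) * cis (u * (h * (\<Sum>k<Suc n. f (a k)))))"
  have F: "F (\<lambda>k\<in>{..n}. Y (real k * h) \<omega>) = indicator {\<omega> \<in> space M. Y 0 \<omega> = y0} \<omega>
             * cis (u * (h * (\<Sum>k<Suc n. f (Y (real k * h) \<omega>))))" if "\<omega> \<in> space M" for \<omega>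
  proof -
    have "(\<Sum>k<Suc n. f ((\<lambda>k\<in>{..n}. Y (real k * h) \<omega>) k)) = (\<Sum>k<Suc n. f (Y (real k * h) \<omega>))"
      by (intro sum.cong) auto
    then show ?thesis
      using that unfolding F_def by (simp add: indicator_def)
  qed
  have A: "(A *v g) $ \<alpha> = cis (u * h * f \<alpha>) * (map_matrix of_real (P h) *v g) $ \<alpha>" for \<alpha>
    by (simp add: A_def matrix_vector_mult_def sum_distrib_left mult.assoc)
  have "(LINT \<omega>|M. indicator {\<omega> \<in> space M. Y 0 \<omega> = y0} \<omega>
             * cis (u * (h * (\<Sum>k<Suc n. f (Y (real k * h) \<omega>)))) * g $ Y (real (Suc n) * h) \<omega>)
      = (LINT \<omega>|M. F (\<lambda>k\<in>{..n}. Y (real k * h) \<omega>) * g $ Y (real (Suc n) * h) \<omega>)"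
    by (intro Bochner_Integration.integral_cong refl) (simp only: F)
  also have "\<dots> = (LINT \<omega>|M. F (\<lambda>k\<in>{..n}. Y (real k * h) \<omega>) * (map_matrix of_real (P h) *v g) $ Y (real n * h) \<omega>)"
    by (rule integral_path_Suc[OF assms(1)])
  also have "\<dots> = (LINT \<omega>|M. indicator {\<omega> \<in> space M. Y 0 \<omega> = y0} \<omega>
             * cis (u * (h * (\<Sum>k<n. f (Y (real k * h) \<omega>)))) * (A *v g) $ Y (real n * h) \<omega>)"
    by (intro Bochner_Integration.integral_cong refl)
       (simp add: F A distrib_left mult.assoc flip: cis_mult)
  also have "\<dots> = of_real (prob {\<omega> \<in> space M. Y 0 \<omega> = y0}) * ((((*v) A) ^^ n) (A *v g)) $ y0"
    by (rule Suc.IH)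
  finally show ?case by (simp only: funpow_Suc_right o_apply)
qed

end

section \<open>Riemann sums of the path integral\<close>

lemma cmod_cis_diff_le: "norm (cis a - cis b) \<le> \<bar>a - b\<bar>"
proof -
  have "norm (cis a - cis b) = norm (cis b * (exp (\<i> * of_real (a - b)) - (\<Sum>k\<le>0. (\<i> * of_real (a - b)) ^ k / fact k)))"
    by (simp add: cis_conv_exp algebra_simps flip: exp_add)
  also have "\<dots> \<le> \<bar>a - b\<bar>"
    using iexp_approx1[of "a - b" 0] by (simp add: norm_mult)
  finally show ?thesis .
qed

text \<open>
  The process is only measurable for nonnegative times; composing with \<open>max 0\<close> extends it to
  all of the line, so that Fubini can be used with the Lebesgue measure.
\<close>

lemma measurable_process_max_0:
  assumes "measurable_process M Y"
  shows "(\<lambda>(s, \<omega>). Y (max 0 s) \<omega>) \<in> measurable (lborel \<Otimes>\<^sub>M M) (count_space UNIV)"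
proof -
  have "(\<lambda>p. max 0 (fst p) :: real) \<in> measurable (lborel \<Otimes>\<^sub>M M) (restrict_space borel {0::real..})"
    by (rule measurable_restrict_space2) auto
  then have "(\<lambda>p. (max 0 (fst p) :: real, snd p)) \<in> measurable (lborel \<Otimes>\<^sub>M M) (restrict_space borel {0..} \<Otimes>\<^sub>M M)"
    by (rule measurable_Pair) simp
  from measurable_compose[OF this assms[unfolded measurable_process_def]] show ?thesis
    by (simp add: case_prod_unfold)
qed

context continuous_time_markov_chain
begin

text \<open>The increment vanishes unless the two states differ and is at most \<open>2 * B\<close>
  otherwise. The probability that they differ is the average of
  \<open>1 - P r $ \<alpha> $ \<alpha>\<close> over the law of \<open>Y s\<close>. Only the two end
  times are compared, so excursions in between do not matter.\<close>

lemma expectation_increment_le: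
  fixes f :: "'s \<Rightarrow> real"
  assumes "s \<ge> 0" "r \<ge> 0" and B: "\<And>\<alpha>. \<bar>f \<alpha>\<bar> \<le> B" and stay: "\<And>\<alpha>. 1 - P r $ \<alpha> $ \<alpha> \<le> \<epsilon>"
  shows "expectation (\<lambda>\<omega>. \<bar>f (Y (s + r) \<omega>) - f (Y s \<omega>)\<bar>) \<le> 2 * B * \<epsilon>"
proof -
  have B0: "B \<ge> 0" using B[of undefined] by linarith
  have B2: "\<bar>f \<alpha> - f \<beta>\<bar> \<le> 2 * B" for \<alpha> \<beta> using B[of \<alpha>] B[of \<beta>] by linarith
  note [measurable] = measurable_state[OF assms(1)] measurable_state[of "s + r"]
  have sr: "s + r \<ge> 0" using assms by simp
  let ?E = "{\<omega> \<in> space M. Y (s + r) \<omega> = Y s \<omega>}"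
  have E_UN: "?E = (\<Union>\<alpha>. {\<omega> \<in> space M. Y (s + r) \<omega> = \<alpha> \<and> Y s \<omega> = \<alpha>})"
    by auto
  have ev: "{\<omega> \<in> space M. Y (s + r) \<omega> = \<alpha> \<and> Y s \<omega> = \<alpha>} \<in> events" "{\<omega> \<in> space M. Y s \<omega> = \<alpha>} \<in> events" for \<alpha>
    using assms sr by measurable
  have E: "?E \<in> events" unfolding E_UN using ev by (intro sets.finite_UN) auto
  have "1 = prob (\<Union>\<alpha>. {\<omega> \<in> space M. Y s \<omega> = \<alpha>})"
    unfolding prob_space[symmetric] by (rule arg_cong[where f = prob]) auto
  also have "\<dots> = (\<Sum>\<alpha>\<in>UNIV. prob {\<omega> \<in> space M. Y s \<omega> = \<alpha>})"
    by (rule finite_measure_finite_Union) (use ev in \<open>auto simp: disjoint_family_on_def\<close>)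
  finally have total: "(\<Sum>\<alpha>\<in>UNIV. prob {\<omega> \<in> space M. Y s \<omega> = \<alpha>}) = 1" ..
  have "prob ?E = (\<Sum>\<alpha>\<in>UNIV. prob {\<omega> \<in> space M. Y (s + r) \<omega> = \<alpha> \<and> Y s \<omega> = \<alpha>})"
    unfolding E_UN by (rule finite_measure_finite_Union) (use ev in \<open>auto simp: disjoint_family_on_def\<close>)
  also have "\<dots> = (\<Sum>\<alpha>\<in>UNIV. prob {\<omega> \<in> space M. Y s \<omega> = \<alpha>} * P r $ \<alpha> $ \<alpha>)"
    using prob_transition[OF assms(1,2)] by simp
  also have "\<dots> \<ge> (\<Sum>\<alpha>\<in>UNIV. prob {\<omega> \<in> space M. Y s \<omega> = \<alpha>} * (1 - \<epsilon>))"
    by (intro sum_mono mult_left_mono) (use stay in \<open>auto simp: algebra_simps\<close>)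
  finally have "1 - \<epsilon> \<le> prob ?E"
    by (simp add: total flip: sum_distrib_right)
  then have ne: "prob (space M - ?E) \<le> \<epsilon>" using prob_compl[OF E] by simp
  have "expectation (\<lambda>\<omega>. \<bar>f (Y (s + r) \<omega>) - f (Y s \<omega>)\<bar>) \<le> expectation (\<lambda>\<omega>. 2 * B * indicator (space M - ?E) \<omega>)"
  proof (rule integral_mono)
    show "integrable M (\<lambda>\<omega>. \<bar>f (Y (s + r) \<omega>) - f (Y s \<omega>)\<bar>)"
    proof (rule integrable_const_bound[where B = "2 * B"])
      show "AE \<omega> in M. norm \<bar>f (Y (s + r) \<omega>) - f (Y s \<omega>)\<bar> \<le> 2 * B"
        using B2 by (intro AE_I2) simp
    qed (use sr in measurable)
    show "integrable M (\<lambda>\<omega>. 2 * B * indicator (space M - ?E) \<omega> :: real)"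
      using E by (intro integrable_mult_right integrable_real_indicator) (auto simp: emeasure_eq_measure)
    fix \<omega> assume "\<omega> \<in> space M"
    then show "\<bar>f (Y (s + r) \<omega>) - f (Y s \<omega>)\<bar> \<le> 2 * B * indicator (space M - ?E) \<omega>"
      using B2 by (auto simp: indicator_def)
  qed
  also have "\<dots> = 2 * B * prob (space M - ?E)"
    using E by simp
  also have "\<dots> \<le> 2 * B * \<epsilon>"
    using ne B0 by (intro mult_left_mono) auto
  finally show ?thesis .
qed

context
  fixes f :: "'s \<Rightarrow> real" and B :: real
  assumes meas: "measurable_process M Y"
    and B: "\<And>\<alpha>. \<bar>f \<alpha>\<bar> \<le> B"
begin

lemma path_measurable [measurable]:
  "(\<lambda>p. f (Y (max 0 (fst p)) (snd p))) \<in> borel_measurable (lborel \<Otimes>\<^sub>M M)"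
  using measurable_compose[OF measurable_process_max_0[OF meas], of f borel]
  by (simp add: case_prod_unfold)

lemma state_measurable: "s \<ge> 0 \<Longrightarrow> (\<lambda>\<omega>. f (Y s \<omega>)) \<in> borel_measurable M"
  using measurable_compose[OF measurable_state[of s], of f borel] by simp

text \<open>A section of the jointly measurable process is measurable, and it is bounded by
  \<open>B\<close> on a set of finite measure, where \<open>max 0\<close> has no effect.\<close>

lemma set_integrable_path:
  assumes "\<omega> \<in> space M" "S \<subseteq> {0..t}" "S \<in> sets borel"
  shows "set_integrable lborel S (\<lambda>s. f (Y s \<omega>))"
proof -
  have "(\<lambda>s. f (Y (max 0 s) \<omega>)) \<in> borel_measurable lborel"
    using measurable_compose[OF measurable_Pair2'[OF assms(1)] path_measurable] by simp
  moreover have "emeasure lborel S \<le> emeasure lborel {0..t}"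
    using assms by (intro emeasure_mono) auto
  then have "emeasure lborel S < \<infinity>"
    by (rule le_less_trans) (simp add: emeasure_lborel_Icc_eq)
  ultimately have "integrable lborel (\<lambda>s. indicator S s *\<^sub>R f (Y (max 0 s) \<omega>))"
    by (intro integrableI_bounded_set_indicator[where B = B]) (use assms B in auto)
  then show ?thesis
    unfolding set_integrable_def
    by (rule Bochner_Integration.integrable_cong[THEN iffD1, rotated 2])
       (use assms in \<open>auto simp: indicator_def max_def\<close>)
qed

lemma path_integral_measurable: "path_integral f Y t \<in> borel_measurable M"
proof -
  \<comment> \<open>The coordinates are swapped because the variable to be integrated out must come
    second.\<close>
  have [measurable]: "(\<lambda>p. f (Y (max 0 (snd p)) (fst p))) \<in> borel_measurable (M \<Otimes>\<^sub>M lborel)"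
    using measurable_compose[OF measurable_pair_swap' path_measurable] by (simp add: case_prod_unfold)
  have "(\<lambda>p. indicator {0..t} (snd p) *\<^sub>R f (Y (max 0 (snd p)) (fst p))) \<in> borel_measurable (M \<Otimes>\<^sub>M lborel)"
    by measurable
  then have "(\<lambda>\<omega>. LINT s|lborel. indicator {0..t} s *\<^sub>R f (Y (max 0 s) \<omega>)) \<in> borel_measurable M"
    by (intro sigma_finite_measure.borel_measurable_lebesgue_integral)
       (auto simp: case_prod_unfold intro: sigma_finite_lborel)
  also have "(\<lambda>\<omega>. LINT s|lborel. indicator {0..t} s *\<^sub>R f (Y (max 0 s) \<omega>)) = path_integral f Y t"
    unfolding path_integral_def set_lebesgue_integral_def fun_eq_iff
    by (intro allI Bochner_Integration.integral_cong) (auto simp: indicator_def max_def)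
  finally show ?thesis .
qed

text \<open>Fubini moves the expectation inside the time integral, where at each fixed time the
  increment from \<open>a\<close> has mean at most \<open>2 * B * \<epsilon>\<close>; the length of
  the block gives the factor \<open>h\<close>. The block is half open so that it can be attached to
  \<open>{0..a}\<close> without overlap.\<close>

lemma expectation_block_error_le:
  assumes "a \<ge> 0" "h \<ge> 0" and stay: "\<And>r \<alpha>. 0 \<le> r \<Longrightarrow> r \<le> h \<Longrightarrow> 1 - P r $ \<alpha> $ \<alpha> \<le> \<epsilon>"
  shows "integrable M (\<lambda>\<omega>. (LINT s:{a<..a + h}|lborel. f (Y s \<omega>)) - h * f (Y a \<omega>))" (is "integrable M ?D")
    and "expectation (\<lambda>\<omega>. \<bar>(LINT s:{a<..a + h}|lborel. f (Y s \<omega>)) - h * f (Y a \<omega>)\<bar>) \<le> 2 * B * \<epsilon> * h"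
proof -
  interpret L: pair_sigma_finite lborel M
    by (intro pair_sigma_finite.intro sigma_finite_lborel) unfold_locales
  define \<phi> where "\<phi> = (\<lambda>s \<omega>. indicator {a<..a + h} s *\<^sub>R (f (Y (max 0 s) \<omega>) - f (Y a \<omega>)))"
  have B2: "\<bar>f \<alpha> - f \<beta>\<bar> \<le> 2 * B" for \<alpha> \<beta> using B[of \<alpha>] B[of \<beta>] by linarith
  note [measurable] = state_measurable[OF assms(1)]
  have int: "integrable (lborel \<Otimes>\<^sub>M M) (\<lambda>(s, \<omega>). \<phi> s \<omega>)"
  proof (rule integrableI_bounded_set[where A = "{a<..a + h} \<times> space M" and B = "2 * B"])
    show "(\<lambda>(s, \<omega>). \<phi> s \<omega>) \<in> borel_measurable (lborel \<Otimes>\<^sub>M M)"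
      unfolding \<phi>_def case_prod_unfold by measurable
    show "emeasure (lborel \<Otimes>\<^sub>M M) ({a<..a + h} \<times> space M) < \<infinity>"
      using assms by (simp add: sigma_finite_measure.emeasure_pair_measure_Times[OF sigma_finite_measure_axioms] emeasure_space_1)
    show "AE p in lborel \<Otimes>\<^sub>M M. p \<in> {a<..a + h} \<times> space M \<longrightarrow> norm (case p of (s, \<omega>) \<Rightarrow> \<phi> s \<omega>) \<le> 2 * B"
      by (intro AE_I2) (auto simp: \<phi>_def B2)
    show "AE p in lborel \<Otimes>\<^sub>M M. p \<notin> {a<..a + h} \<times> space M \<longrightarrow> (case p of (s, \<omega>) \<Rightarrow> \<phi> s \<omega>) = 0"
      by (intro AE_I2) (auto simp: \<phi>_def space_pair_measure indicator_def split: if_splits)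
  qed auto
  then have int_abs: "integrable (lborel \<Otimes>\<^sub>M M) (\<lambda>(s, \<omega>). \<bar>\<phi> s \<omega>\<bar>)"
    using integrable_abs[OF int] by (simp add: case_prod_unfold)
  have D: "?D \<omega> = (LINT s|lborel. \<phi> s \<omega>)" if "\<omega> \<in> space M" for \<omega>
  proof -
    have "(LINT s|lborel. \<phi> s \<omega>) = (LINT s:{a<..a + h}|lborel. f (Y s \<omega>) - f (Y a \<omega>))"
      unfolding set_lebesgue_integral_def \<phi>_def
      by (intro Bochner_Integration.integral_cong) (use assms in \<open>auto simp: indicator_def max_def\<close>)
    moreover have "{a<..a + h} \<subseteq> {0..a + h}" using assms by auto
    \<comment> \<open>The sample term \<open>h * f (Y a \<omega>)\<close> is the integral of a
      constant over the block.\<close>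
    then have "(LINT s:{a<..a + h}|lborel. f (Y s \<omega>) - f (Y a \<omega>)) = ?D \<omega>"
      using set_integrable_path[OF that, of "{a<..a + h}" "a + h"] assms
      by (subst set_integral_diff) (auto simp: set_integrable_def set_lebesgue_integral_def)
    ultimately show ?thesis by simp
  qed
  show D_int: "integrable M ?D"
    by (rule Bochner_Integration.integrable_cong[THEN iffD2, OF refl D L.integrable_snd[OF int]])
  have "expectation (\<lambda>\<omega>. \<bar>?D \<omega>\<bar>) \<le> (LINT \<omega>|M. LINT s|lborel. \<bar>\<phi> s \<omega>\<bar>)"
  proof (rule integral_mono[OF integrable_abs[OF D_int] L.integrable_snd[OF int_abs]])
    fix \<omega> assume "\<omega> \<in> space M"
    then show "\<bar>?D \<omega>\<bar> \<le> (LINT s|lborel. \<bar>\<phi> s \<omega>\<bar>)"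
      using integral_norm_bound[of lborel "\<lambda>s. \<phi> s \<omega>"] by (simp add: D)
  qed
  also have "\<dots> = (LINT s|lborel. LINT \<omega>|M. \<bar>\<phi> s \<omega>\<bar>)"
    by (rule L.Fubini_integral[OF int_abs])
  also have "\<dots> \<le> (LINT s|lborel. indicator {a<..a + h} s *\<^sub>R (2 * B * \<epsilon>))"
  proof (rule integral_mono[OF L.integrable_fst[OF int_abs]])
    show "integrable lborel (\<lambda>s. indicator {a<..a + h} s *\<^sub>R (2 * B * \<epsilon>))"
      using assms by (intro integrable_scaleR_left integrable_real_indicator) auto
    fix s
    show "(LINT \<omega>|M. \<bar>\<phi> s \<omega>\<bar>) \<le> indicator {a<..a + h} s *\<^sub>R (2 * B * \<epsilon>)"
    proof (cases "s \<in> {a<..a + h}")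
      case True
      then have "s = a + (s - a)" "0 \<le> s - a" "s - a \<le> h" by auto
      then show ?thesis
        using expectation_increment_le[of a "s - a" f B \<epsilon>] B stay[of "s - a"] assms True
        by (simp add: \<phi>_def max_def)
    qed (simp add: \<phi>_def)
  qed
  also have "\<dots> = 2 * B * \<epsilon> * h"
    using assms by simp
  finally show "expectation (\<lambda>\<omega>. \<bar>?D \<omega>\<bar>) \<le> 2 * B * \<epsilon> * h" .
qed

text \<open>Blocks are appended one at a time and their mean errors add. Integrability is part of
  the claim because the induction step needs it to split the expectation.\<close>

lemma expectation_riemann_error_le:
  assumes "h \<ge> 0" and stay: "\<And>r \<alpha>. 0 \<le> r \<Longrightarrow> r \<le> h \<Longrightarrow> 1 - P r $ \<alpha> $ \<alpha> \<le> \<epsilon>"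
  shows "integrable M (\<lambda>\<omega>. path_integral f Y (real n * h) \<omega> - h * (\<Sum>k<n. f (Y (real k * h) \<omega>)))
    \<and> expectation (\<lambda>\<omega>. \<bar>path_integral f Y (real n * h) \<omega> - h * (\<Sum>k<n. f (Y (real k * h) \<omega>))\<bar>)
      \<le> 2 * B * \<epsilon> * (real n * h)"
proof (induction n)
  case 0
  have "path_integral f Y 0 \<omega> = 0" for \<omega>
  proof -
    have "AE s in lborel. indicator {0..0} s *\<^sub>R f (Y s \<omega>) = 0"
      using AE_lborel_singleton[of 0] by eventually_elim simp
    then show ?thesis
      unfolding path_integral_def set_lebesgue_integral_def by (rule integral_eq_zero_AE)
  qed
  then show ?case by simp
next
  case (Suc n)
  define E where "E = (\<lambda>n \<omega>. path_integral f Y (real n * h) \<omega> - h * (\<Sum>k<n. f (Y (real k * h) \<omega>)))"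
  define a where "a = real n * h"
  have a: "a \<ge> 0" using assms by (simp add: a_def)
  define D where "D = (\<lambda>\<omega>. (LINT s:{a<..a + h}|lborel. f (Y s \<omega>)) - h * f (Y a \<omega>))"
  have D: "integrable M D" "expectation (\<lambda>\<omega>. \<bar>D \<omega>\<bar>) \<le> 2 * B * \<epsilon> * h"
    unfolding D_def using expectation_block_error_le[OF a assms] by auto
  have E: "integrable M (E n)" "expectation (\<lambda>\<omega>. \<bar>E n \<omega>\<bar>) \<le> 2 * B * \<epsilon> * (real n * h)"
    using Suc.IH by (simp_all add: E_def)
  have split: "E (Suc n) \<omega> = E n \<omega> + D \<omega>" if "\<omega> \<in> space M" for \<omega>
  proof -
    have eq: "{0..a + h} = {0..a} \<union> {a<..a + h}" using a assms by auto
    have "path_integral f Y (a + h) \<omega> = path_integral f Y a \<omega> + (LINT s:{a<..a + h}|lborel. f (Y s \<omega>))"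
      unfolding path_integral_def eq
      by (intro set_integral_Un set_integrable_path[OF that, of _ "a + h"]) (use a assms in auto)
    moreover have "real (Suc n) * h = a + h" by (simp add: a_def algebra_simps)
    ultimately show ?thesis
      unfolding E_def D_def by (simp add: a_def algebra_simps)
  qed
  have int: "integrable M (E (Suc n))"
    by (rule Bochner_Integration.integrable_cong[THEN iffD2, OF refl split]) (use D E in auto)
  have "expectation (\<lambda>\<omega>. \<bar>E (Suc n) \<omega>\<bar>) \<le> expectation (\<lambda>\<omega>. \<bar>E n \<omega>\<bar> + \<bar>D \<omega>\<bar>)"
    by (rule integral_mono) (use int D E in \<open>auto simp: split abs_triangle_ineq\<close>)
  also have "\<dots> \<le> 2 * B * \<epsilon> * (real n * h) + 2 * B * \<epsilon> * h"
    using D E by simp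
  finally show ?case
    using int unfolding E_def by (simp add: algebra_simps)
qed

text \<open>The phase is Lipschitz with constant \<open>\<bar>u\<bar>\<close> and the indicator is
  at most 1, so the mean error of the Riemann sum passes to the expectations.\<close>

lemma char_fun_riemann_error_le:
  fixes u :: real
  assumes "h > 0" and stay: "\<And>r \<alpha>. 0 \<le> r \<Longrightarrow> r \<le> h \<Longrightarrow> 1 - P r $ \<alpha> $ \<alpha> \<le> \<epsilon>"
  defines "A \<equiv> (\<chi> \<alpha> \<beta>. cis (u * h * f \<alpha>) * of_real (P h $ \<alpha> $ \<beta>))"
  shows "norm ((LINT \<omega>|M. indicator {\<omega> \<in> space M. Y 0 \<omega> = y0} \<omega> * cis (u * path_integral f Y (real n * h) \<omega>))
      - of_real (prob {\<omega> \<in> space M. Y 0 \<omega> = y0}) * ((((*v) A) ^^ n) (\<chi> \<alpha>. 1)) $ y0)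
    \<le> \<bar>u\<bar> * (2 * B * \<epsilon> * (real n * h))"
proof -
  define I where "I = (indicator {\<omega> \<in> space M. Y 0 \<omega> = y0} :: 'w \<Rightarrow> complex)"
  define S where "S = (\<lambda>\<omega>. h * (\<Sum>k<n. f (Y (real k * h) \<omega>)))"
  let ?X = "path_integral f Y (real n * h)"
  have I_le: "norm (I \<omega>) \<le> 1" for \<omega> by (simp add: I_def indicator_def)
  have "{\<omega> \<in> space M. Y 0 \<omega> = y0} \<in> events" by measurable
  then have [measurable]: "I \<in> borel_measurable M" by (simp add: I_def)
  note [measurable] = path_integral_measurable
  have [measurable]: "(\<lambda>\<omega>. f (Y (real k * h) \<omega>)) \<in> borel_measurable M" for k
    using assms(1) by (intro state_measurable) simp
  have [measurable]: "S \<in> borel_measurable M" unfolding S_def by measurable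
  have int: "integrable M (\<lambda>\<omega>. I \<omega> * cis (u * Z \<omega>))" if [measurable]: "Z \<in> borel_measurable M" for Z
    by (rule integrable_const_bound[where B = 1]) (use I_le in \<open>auto simp: norm_mult cis_conv_exp\<close>)
  have err: "integrable M (\<lambda>\<omega>. ?X \<omega> - S \<omega>)" "expectation (\<lambda>\<omega>. \<bar>?X \<omega> - S \<omega>\<bar>) \<le> 2 * B * \<epsilon> * (real n * h)"
    using expectation_riemann_error_le[of h \<epsilon> n] assms(1) stay by (simp_all add: S_def)
  have riemann: "of_real (prob {\<omega> \<in> space M. Y 0 \<omega> = y0}) * ((((*v) A) ^^ n) (\<chi> \<alpha>. 1)) $ y0 = (LINT \<omega>|M. I \<omega> * cis (u * S \<omega>))"
    using integral_riemann_sum_exp[OF assms(1), of y0 u f n "\<chi> \<alpha>. 1"] by (simp add: I_def S_def A_def)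
  have "norm ((LINT \<omega>|M. I \<omega> * cis (u * ?X \<omega>)) - (LINT \<omega>|M. I \<omega> * cis (u * S \<omega>)))
      = norm (LINT \<omega>|M. I \<omega> * cis (u * ?X \<omega>) - I \<omega> * cis (u * S \<omega>))"
    by (subst Bochner_Integration.integral_diff) (use int in auto)
  also have "\<dots> \<le> (LINT \<omega>|M. norm (I \<omega> * cis (u * ?X \<omega>) - I \<omega> * cis (u * S \<omega>)))"
    by (rule integral_norm_bound)
  also have "\<dots> \<le> (LINT \<omega>|M. \<bar>u\<bar> * \<bar>?X \<omega> - S \<omega>\<bar>)"
  proof (rule integral_mono)
    fix \<omega>
    have "norm (I \<omega> * (cis (u * ?X \<omega>) - cis (u * S \<omega>))) \<le> 1 * \<bar>u * ?X \<omega> - u * S \<omega>\<bar>"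
      unfolding norm_mult by (intro mult_mono I_le cmod_cis_diff_le) auto
    then show "norm (I \<omega> * cis (u * ?X \<omega>) - I \<omega> * cis (u * S \<omega>)) \<le> \<bar>u\<bar> * \<bar>?X \<omega> - S \<omega>\<bar>"
      by (simp add: right_diff_distrib flip: abs_mult)
  qed (use int err in auto)
  also have "\<dots> \<le> \<bar>u\<bar> * (2 * B * \<epsilon> * (real n * h))"
    using err by (simp add: mult_left_mono)
  finally show ?thesis unfolding riemann I_def .
qed

end

text \<open>Finitely many states admit a common \<open>\<delta>\<close>. The limit from the right
  says nothing at \<open>r = 0\<close>; that case is \<open>P_0\<close>.\<close>

lemma diagonal_close_to_1:
  assumes "\<epsilon> > 0"
  obtains \<delta> where "\<delta> > 0" "\<And>r \<alpha>. 0 \<le> r \<Longrightarrow> r < \<delta> \<Longrightarrow> 1 - P r $ \<alpha> $ \<alpha> \<le> \<epsilon>"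
proof -
  have "((\<lambda>r. P r $ \<alpha> $ \<alpha>) \<longlongrightarrow> mat 1 $ \<alpha> $ \<alpha>) (at_right 0)" for \<alpha>
    by (intro tendsto_vec_nth P_continuous_at_0)
  then have "\<forall>\<^sub>F r in at_right 0. 1 - \<epsilon> < P r $ \<alpha> $ \<alpha>" for \<alpha>
    using assms by (intro order_tendstoD) (auto simp: mat_def)
  then have "\<forall>\<^sub>F r in at_right 0. \<forall>\<alpha>. 1 - \<epsilon> < P r $ \<alpha> $ \<alpha>"
    by (simp add: eventually_all_finite)
  then obtain \<delta> where \<delta>: "\<delta> > 0" "\<And>r \<alpha>. 0 < r \<Longrightarrow> r < \<delta> \<Longrightarrow> 1 - \<epsilon> < P r $ \<alpha> $ \<alpha>"
    unfolding eventually_at_right_field by auto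
  have "1 - P r $ \<alpha> $ \<alpha> \<le> \<epsilon>" if "0 \<le> r" "r < \<delta>" for r \<alpha>
    using \<delta>(2)[of r \<alpha>] that assms P_0 by (cases "r = 0") (auto simp: mat_def)
  with \<delta>(1) show ?thesis by (rule that)
qed

end

section \<open>The characteristic function\<close>

text \<open>The uniform measure on \<open>A\<close> is \<open>M\<close> with the indicator divided
  by \<open>prob A\<close> as density; positivity allows this extended quotient to be written as a
  real one.\<close>

lemma (in prob_space) cond_expectation_eq:
  assumes [measurable]: "A \<in> events" "Z \<in> borel_measurable M" and "prob A > 0"
  shows "cond_expectation M Z A = (LINT \<omega>|M. indicator A \<omega> * Z \<omega>) / of_real (prob A)"
proof -
  have "uniform_measure M A = density M (\<lambda>\<omega>. ennreal (indicator A \<omega> / prob A))"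
    unfolding uniform_measure_def
    by (intro density_cong) (use assms(3) in \<open>auto simp: emeasure_eq_measure indicator_def simp flip: divide_ennreal\<close>)
  then have "cond_expectation M Z A = (LINT \<omega>|M. (indicator A \<omega> / prob A) *\<^sub>R Z \<omega>)"
    unfolding cond_expectation_def by (simp add: integral_density)
  also have "\<dots> = (LINT \<omega>|M. indicator A \<omega> * Z \<omega> / of_real (prob A))"
    by (intro Bochner_Integration.integral_cong) (auto simp: indicator_def scaleR_conv_of_real)
  finally show ?thesis by simp
qed

theorem theorem2:
  fixes M :: "'w measure"
    and Y :: "real \<Rightarrow> 'w \<Rightarrow> 's::finite"
    and P :: "real \<Rightarrow> real^'s^'s"
    and G :: "real^'s^'s"
    and f :: "'s \<Rightarrow> real"
    and t u :: real
    and y0 :: 's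
  assumes "continuous_time_markov_chain M Y P"
    and "infinitesimal_generator P G"
    and "measurable_process M Y"
    and "inj f"
    and "t \<ge> 0"
    and "measure M {\<omega> \<in> space M. Y 0 \<omega> = y0} > 0"
  shows "cond_expectation M (\<lambda>\<omega>. exp (\<i> * of_real u * of_real (path_integral f Y t \<omega>)))
           {\<omega> \<in> space M. Y 0 \<omega> = y0} =
         (matrix_exp (t *\<^sub>R (map_matrix complex_of_real G
              + map_matrix (\<lambda>z. \<i> * of_real u * z) (matrix (mult_op f))))
            *v (\<chi> y. 1)) $ y0"
proof -
  interpret continuous_time_markov_chain M Y P by fact
  define K where "K = map_matrix complex_of_real G + map_matrix (\<lambda>z. \<i> * of_real u * z) (matrix (mult_op f))"
  have K: "K $ \<alpha> $ \<beta> = of_real (G $ \<alpha> $ \<beta>) + (if \<alpha> = \<beta> then \<i> * of_real (u * f \<alpha>) else 0)" for \<alpha> \<beta>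
    by (auto simp: K_def map_matrix_def matrix_def mult_op_def axis_def)
  define B where "B = (\<Sum>\<alpha>\<in>UNIV. \<bar>f \<alpha>\<bar>)"
  have B: "\<bar>f \<alpha>\<bar> \<le> B" for \<alpha>
    unfolding B_def by (rule member_le_sum) auto
  then have B0: "B \<ge> 0" using order_trans[OF abs_ge_zero] by blast
  have P: "P h = matrix_exp (h *\<^sub>R G)" if "h \<ge> 0" for h
    using assms(2) that by (simp add: infinitesimal_generator_def)
  \<comment> \<open>\<open>P\<close> is constrained at nonnegative times only. With
    \<open>matrix_exp\<close> in its place, \<open>A\<close> is also meaningful for negative
    \<open>h\<close> and has a two-sided derivative at 0.\<close>
  define A where "A = (\<lambda>h. (\<chi> \<alpha> \<beta>. cis (u * h * f \<alpha>) * of_real (matrix_exp (h *\<^sub>R G) $ \<alpha> $ \<beta>)) :: complex^'s^'s)"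
  have A_P: "A h = (\<chi> \<alpha> \<beta>. cis (u * h * f \<alpha>) * of_real (P h $ \<alpha> $ \<beta>))" if "h \<ge> 0" for h
    using P[OF that] by (simp add: A_def)
  have A0: "A 0 = mat 1"
    by (simp add: A_P P_0 vec_eq_iff mat_def)
  have deriv: "((\<lambda>h. A h $ \<alpha> $ \<beta>) has_vector_derivative K $ \<alpha> $ \<beta>) (at 0)" for \<alpha> \<beta>
  proof -
    have "((\<lambda>h. cis (u * h * f \<alpha>)) has_vector_derivative \<i> * of_real (u * f \<alpha>)) (at 0)"
    proof -
      have "((\<lambda>z. exp (\<i> * of_real (u * f \<alpha>) * z)) has_field_derivative \<i> * of_real (u * f \<alpha>)) (at (of_real 0))"
        by (auto intro!: derivative_eq_intros)
      from has_vector_derivative_real_field[OF this] show ?thesis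
        by (simp add: cis_conv_exp mult_ac)
    qed
    moreover have "((\<lambda>h. complex_of_real (matrix_exp (h *\<^sub>R G) $ \<alpha> $ \<beta>)) has_vector_derivative of_real (G $ \<alpha> $ \<beta>)) (at 0)"
      by (rule has_vector_derivative_of_real) (use matrix_exp_component_has_derivative_at_0 in \<open>simp add: has_real_derivative_iff_has_vector_derivative\<close>)
    ultimately have "((\<lambda>h. A h $ \<alpha> $ \<beta>) has_vector_derivative
        cis (u * 0 * f \<alpha>) * of_real (G $ \<alpha> $ \<beta>) + \<i> * of_real (u * f \<alpha>) * of_real (matrix_exp (0 *\<^sub>R G) $ \<alpha> $ \<beta>)) (at 0)"
      unfolding A_def vec_lambda_beta by (rule has_vector_derivative_mult)
    \<comment> \<open>At 0 the exponential is the identity, so the derivative of the phase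
      contributes on the diagonal only, as in \<open>K\<close>.\<close>
    moreover have "matrix_exp (0 *\<^sub>R G) = mat 1" using P[of 0] P_0 by simp
    ultimately show ?thesis
      by (simp add: K mat_def split: if_splits)
  qed
  have contraction: "norm ((A h *v x) $ \<alpha>) \<le> c" if "0 \<le> h" "\<And>\<beta>. norm (x $ \<beta>) \<le> c" for h x c \<alpha>
  proof -
    have tm: "0 \<le> P h $ \<alpha> $ \<beta>" "(\<Sum>\<beta>\<in>UNIV. P h $ \<alpha> $ \<beta>) = 1" for \<beta>
      using transition_matrix[OF that(1)] by (auto simp: transition_matrix_def)
    have "norm ((A h *v x) $ \<alpha>) \<le> (\<Sum>\<beta>\<in>UNIV. P h $ \<alpha> $ \<beta> * c)"
      unfolding matrix_vector_mult_def vec_lambda_beta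
      by (intro sum_norm_le) (use tm that in \<open>auto simp: A_P norm_mult intro!: mult_left_mono\<close>)
    also have "\<dots> = c" by (simp add: tm flip: sum_distrib_right)
    finally show ?thesis .
  qed
  let ?E = "{\<omega> \<in> space M. Y 0 \<omega> = y0}"
  define w where "w = (matrix_exp (t *\<^sub>R K) *v (\<chi> y. 1)) $ y0"
  define I where "I = (LINT \<omega>|M. indicator ?E \<omega> * cis (u * path_integral f Y t \<omega>))"
  \<comment> \<open>The Riemann sum contributes \<open>2 * B * \<bar>u\<bar> * t\<close> and the
    product formula \<open>t\<close>, both times \<open>\<epsilon>\<close>; the latter error is
    weighted by a probability.\<close>
  have bound: "norm (I - of_real (prob ?E) * w) \<le> \<epsilon> * (t * (2 * B * \<bar>u\<bar> + 1))" if eps: "\<epsilon> > 0" for \<epsilon>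
  proof -
    obtain \<delta>1 where \<delta>1: "\<delta>1 > 0" "\<And>r \<alpha>. 0 \<le> r \<Longrightarrow> r < \<delta>1 \<Longrightarrow> 1 - P r $ \<alpha> $ \<alpha> \<le> \<epsilon>"
      using diagonal_close_to_1[OF eps] by metis
    obtain \<delta>2 where \<delta>2: "\<delta>2 > 0"
      "\<And>h n i. 0 \<le> h \<Longrightarrow> h < \<delta>2 \<Longrightarrow> real n * h \<le> t \<Longrightarrow>
         norm ((((*v) (A h) ^^ n) (\<chi> y. 1)) $ i - (matrix_exp ((real n * h) *\<^sub>R K) *v (\<chi> y. 1)) $ i) \<le> \<epsilon> * (real n * h)"
      using matrix_product_formula[OF A0 deriv contraction eps, where v = "\<chi> y. 1" and t = t] by metis
    define \<delta> where "\<delta> = min \<delta>1 \<delta>2"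
    have \<delta>: "\<delta> > 0" using \<delta>1 \<delta>2 by (simp add: \<delta>_def)
    \<comment> \<open>A mesh below \<open>\<delta>\<close> that divides \<open>t\<close> exactly. As
      \<open>h\<close> must be positive, \<open>t = 0\<close> is reached by taking zero
      steps.\<close>
    obtain n h where nh: "h > 0" "h < \<delta>" "real n * h = t"
    proof (cases "t = 0")
      case True
      then show ?thesis using that[of "\<delta> / 2" 0] \<delta> by simp
    next
      case False
      obtain n where n: "t / \<delta> < real n" using reals_Archimedean2 by blast
      moreover have "0 < t / \<delta>" using False \<open>t \<ge> 0\<close> \<delta> by simp
      ultimately have "0 < real n" by linarith
      then show ?thesis
        using that[of "t / real n" n] n False \<open>t \<ge> 0\<close> \<delta> by (simp add: field_simps)
    qed
    let ?v = "(((*v) (A h)) ^^ n) (\<chi> y. 1) $ y0"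
    have "norm (I - of_real (prob ?E) * ?v) \<le> \<bar>u\<bar> * (2 * B * \<epsilon> * t)"
      using char_fun_riemann_error_le[OF assms(3) B nh(1), where \<epsilon> = \<epsilon> and u = u and n = n and ?y0.0 = y0] \<delta>1(2) nh
      by (simp add: I_def A_P \<delta>_def)
    moreover have "norm (of_real (prob ?E) * (?v - w)) \<le> 1 * (\<epsilon> * t)"
      unfolding norm_mult
      by (rule mult_mono) (use \<delta>2(2)[of h n y0] nh in \<open>auto simp: w_def \<delta>_def\<close>)
    moreover have "I - of_real (prob ?E) * w = (I - of_real (prob ?E) * ?v) + of_real (prob ?E) * (?v - w)"
      by (simp add: algebra_simps)
    ultimately have "norm (I - of_real (prob ?E) * w) \<le> \<bar>u\<bar> * (2 * B * \<epsilon> * t) + \<epsilon> * t"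
      by (simp only: mult_1) (rule norm_triangle_mono)
    then show ?thesis by (simp add: algebra_simps)
  qed
  have "norm (I - of_real (prob ?E) * w) \<le> 0 + \<eta>" if "\<eta> > 0" for \<eta>
  proof -
    let ?c = "t * (2 * B * \<bar>u\<bar> + 1)"
    have c: "?c \<ge> 0" using B0 \<open>t \<ge> 0\<close> by (intro mult_nonneg_nonneg add_nonneg_nonneg) auto
    \<comment> \<open>\<open>bound\<close> is used with \<open>\<eta> / (?c + 1)\<close>; the added
      1 avoids a zero denominator when \<open>t = 0\<close>.\<close>
    have "norm (I - of_real (prob ?E) * w) \<le> \<eta> / (?c + 1) * ?c"
      using c that by (intro bound divide_pos_pos) auto
    also have "\<dots> \<le> \<eta>" using c that by (simp add: divide_le_eq)
    finally show ?thesis by simp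
  qed
  then have "norm (I - of_real (prob ?E) * w) \<le> 0" by (rule field_le_epsilon)
  then have I: "I = of_real (prob ?E) * w" by simp
  have ev: "?E \<in> events" by measurable
  note [measurable] = path_integral_measurable[OF assms(3) B]
  have "(\<lambda>\<omega>. exp (\<i> * of_real u * of_real (path_integral f Y t \<omega>))) = (\<lambda>\<omega>. cis (u * path_integral f Y t \<omega>))"
    by (simp add: cis_conv_exp mult.assoc)
  moreover have "(\<lambda>\<omega>. exp (\<i> * of_real u * of_real (path_integral f Y t \<omega>))) \<in> borel_measurable M"
    by measurable
  ultimately have "cond_expectation M (\<lambda>\<omega>. exp (\<i> * of_real u * of_real (path_integral f Y t \<omega>))) ?E = I / of_real (prob ?E)"
    using cond_expectation_eq[OF ev _ assms(6)] by (simp add: I_def)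
  with I assms(6) show ?thesis by (simp add: w_def K_def)
qed

end
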